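(* Let $n\ge1$, let $H=H^\top\in\mathbb{R}^{n\times n}$ be positive semidefinite, let $h\in\mathbb{R}^n$, $h\ne0$, and let $0<\epsilon<2n+\alpha\sqrt{2n}$, where $\alpha=0.3$ and $\delta=0.15$. Run the algorithm described in the context on $(H,h)$, and let $I_\gamma^k,I_\theta^k,I_\phi^k,I_\psi^k$ be the index sets computed at its $k$th iteration. Then the total number of rank-1 updates required by the algorithm is bounded: $$\mathcal{N}_{\mathrm{rank}-1}=\sum_{k=1}^{\mathcal{N}_{\mathrm{iter}}}\big|I_\gamma^k\cup I_\theta^k\cup I_\phi^k\cup I_\psi^k\big|\le\left\lceil\frac{4\eta(\mathcal{N}_{\mathrm{iter}}-1)\sqrt n}{(1-\eta)\log(1+\delta)}\right\rceil,$$ where $\eta=\frac{(1+\delta)^3\alpha}{1-\alpha}$ and $\mathcal{N}_{\mathrm{iter}}$ is the number of iterations defined in the context.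
   Context: Conventions: $\odot$, quotients and reciprocals of vectors are componentwise; $e$ is the all-ones vector, $e_i$ the $i$th unit vector; $M_{\cdot,i}$ is the $i$th column of $M$, $M_{i,i}$ its $i$th diagonal entry. The algorithm solves the box-constrained QP $\min_{z\in\mathbb{R}^n}\frac12z^\top Hz+z^\top h$ s.t. $-e\le z\le e$. Parameters: $\alpha=0.3$, $\delta=0.15$, $\lambda=\frac{\alpha}{\sqrt{2n}}$, $\tilde H=\frac{1}{\|h\|_\infty}H$, $\tilde h=\frac1{\|h\|_\infty}h$, $\sigma=\sqrt2\,\delta(1+\delta)^2\alpha\sqrt{\frac{1+\alpha}{1-\alpha}}+\frac{(1+\delta)^2\alpha^2}{2(1-\alpha)}$, $\beta=\frac{\alpha-\sigma}{1+\alpha/\sqrt{2n}}$, and $$\mathcal{N}_{\mathrm{iter}}=\left\lceil\frac{\log\left(\frac{2n+\alpha\sqrt{2n}}{\epsilon}\right)}{-\log\left(1-\frac{\beta}{\sqrt{2n}}\right)}\right\rceil .$$ Initialization: $\tau=1$, $z=0$, $\gamma=e-\lambda\tilde h$, $\theta=e+\lambda\tilde h$, $\phi=\psi=e$; $(\tilde\gamma,\tilde\theta,\tilde\phi,\tilde\psi)=(\gamma,\theta,\phi,\psi)$; $d=\frac{\tilde\gamma}{\tilde\phi}+\frac{\tilde\theta}{\tilde\psi}$; $M=(2\lambda\tilde H+\mathrm{diag}(d))^{-1}$. For $k=1,\dots,\mathcal{N}_{\mathrm{iter}}$: 1. Let $I_\gamma^k=\{i:\tilde\gamma_i/\gamma_i\notin[\frac1{1+\delta},1+\delta]\}$,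 and define $I_\theta^k,I_\phi^k,I_\psi^k$ in the same way from $(\tilde\theta,\theta)$, $(\tilde\phi,\phi)$, $(\tilde\psi,\psi)$. Set $\tilde\gamma_i\leftarrow\gamma_i$ for $i\in I_\gamma^k$, $\tilde\theta_i\leftarrow\theta_i$ for $i\in I_\theta^k$, $\tilde\phi_i\leftarrow\phi_i$ for $i\in I_\phi^k$, $\tilde\psi_i\leftarrow\psi_i$ for $i\in I_\psi^k$; other entries are unchanged. 2. For each $i\in I_\gamma^k\cup I_\theta^k\cup I_\phi^k\cup I_\psi^k$ perform one rank-1 update: $\Delta\leftarrow\frac{\tilde\gamma_i}{\tilde\phi_i}+\frac{\tilde\theta_i}{\tilde\psi_i}-d_i$, $M\leftarrow M-\frac{\Delta}{1+\Delta M_{i,i}}M_{\cdot,i}M_{\cdot,i}^\top$, $d_i\leftarrow\frac{\tilde\gamma_i}{\tilde\phi_i}+\frac{\tilde\theta_i}{\tilde\psi_i}$. (By the Sherman–Morrison formula, afterwards $M=(2\lambda\tilde H+\mathrm{diag}(\frac{\tilde\gamma}{\tilde\phi}+\frac{\tilde\theta}{\tilde\psi}))^{-1}$.) 3. Compute $\Delta z=M\big(\tau\frac1{\tilde\psi}-\tau\frac1{\tilde\phi}+\frac{\gamma\odot\phi}{\tilde\phi}-\frac{\theta\odot\psi}{\tilde\psi}\big)$, $\Delta\gamma=\frac{\tilde\gamma}{\tilde\phi}\odot\Delta z+\tau\frac1{\tilde\phi}-\frac{\gamma\odot\phi}{\tilde\phi}$, $\Delta\theta=-\frac{\tilde\theta}{\tilde\psi}\odot\Delta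 z+\tau\frac1{\tilde\psi}-\frac{\theta\odot\psi}{\tilde\psi}$, $\Delta\phi=-\Delta z$, $\Delta\psi=\Delta z$. 4. $(z,\gamma,\theta,\phi,\psi)\leftarrow(z,\gamma,\theta,\phi,\psi)+(\Delta z,\Delta\gamma,\Delta\theta,\Delta\phi,\Delta\psi)$. 5. $\tau\leftarrow\big(1-\frac{\beta}{\sqrt{2n}}\big)\tau$. Return $z$. *)

theory Defs
  imports "HOL-Analysis.Analysis"
begin

section \<open>Parameters\<close>

definition alpha :: real where "alpha = 3 / 10"

definition delta :: real where "delta = 15 / 100"

definition eta :: real where "eta = (1 + delta) ^ 3 * alpha / (1 - alpha)"

definition sigma :: real where
  "sigma = sqrt 2 * delta * (1 + delta)\<^sup>2 * alpha * sqrt ((1 + alpha) / (1 - alpha))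
           + (1 + delta)\<^sup>2 * alpha\<^sup>2 / (2 * (1 - alpha))"

definition lambda :: "nat \<Rightarrow> real" where
  "lambda n = alpha / sqrt (2 * real n)"

definition beta :: "nat \<Rightarrow> real" where
  "beta n = (alpha - sigma) / (1 + alpha / sqrt (2 * real n))"

text \<open>
  For \<open>n \<ge> 1\<close> and \<open>0 < \<epsilon> < 2 n + \<alpha> \<surd>(2 n)\<close> the
  quotient is positive, so the conversion to \<open>nat\<close> does not truncate.
\<close>
definition N_iter :: "nat \<Rightarrow> real \<Rightarrow> nat" where
  "N_iter n \<epsilon> =
     nat \<lceil>ln ((2 * real n + alpha * sqrt (2 * real n)) / \<epsilon>)
          / (- ln (1 - beta n / sqrt (2 * real n)))\<rceil>"

section \<open>The algorithm\<close>

text \<open>The suffix \<open>_t\<close> marks the approximate (tilde) copies.\<close>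
record ('n::finite) ipm_state =
  st_tau :: real
  st_z :: "real ^ 'n"
  st_gamma :: "real ^ 'n"
  st_theta :: "real ^ 'n"
  st_phi :: "real ^ 'n"
  st_psi :: "real ^ 'n"
  st_gamma_t :: "real ^ 'n"
  st_theta_t :: "real ^ 'n"
  st_phi_t :: "real ^ 'n"
  st_psi_t :: "real ^ 'n"
  st_d :: "real ^ 'n"
  st_M :: "real ^ 'n ^ 'n"

definition diag :: "real ^ 'n \<Rightarrow> real ^ 'n ^ 'n" where
  "diag d = (\<chi> i j. if i = j then d $ i else 0)"

definition init_state :: "real ^ 'n ^ 'n \<Rightarrow> real ^ 'n \<Rightarrow> 'n ipm_state" where
  "init_state H h =
     (let lam = lambda CARD('n);
          Hs = (1 / infnorm h) *\<^sub>R H;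
          hs = (1 / infnorm h) *\<^sub>R h;
          \<gamma> = (\<chi> i. 1 - lam * hs $ i);
          \<theta> = (\<chi> i. 1 + lam * hs $ i);
          \<phi> = (\<chi> i. 1);
          \<psi> = (\<chi> i. 1);
          d = (\<chi> i. \<gamma> $ i / \<phi> $ i + \<theta> $ i / \<psi> $ i)
      in \<lparr> st_tau = 1, st_z = 0,
           st_gamma = \<gamma>, st_theta = \<theta>, st_phi = \<phi>, st_psi = \<psi>,
           st_gamma_t = \<gamma>, st_theta_t = \<theta>, st_phi_t = \<phi>, st_psi_t = \<psi>,
           st_d = d,
           st_M = matrix_inv ((2 * lam) *\<^sub>R Hs + diag d) \<rparr>)"

definition stale :: "real ^ 'n \<Rightarrow> real ^ 'n \<Rightarrow> 'n set" where
  "stale xt x = {i. xt $ i / x $ i \<notin> {1 / (1 + delta) .. 1 + delta}}"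

definition I_gamma :: "'n::finite ipm_state \<Rightarrow> 'n set" where
  "I_gamma S = stale (st_gamma_t S) (st_gamma S)"

definition I_theta :: "'n::finite ipm_state \<Rightarrow> 'n set" where
  "I_theta S = stale (st_theta_t S) (st_theta S)"

definition I_phi :: "'n::finite ipm_state \<Rightarrow> 'n set" where
  "I_phi S = stale (st_phi_t S) (st_phi S)"

definition I_psi :: "'n::finite ipm_state \<Rightarrow> 'n set" where
  "I_psi S = stale (st_psi_t S) (st_psi S)"

definition refresh :: "'n::finite ipm_state \<Rightarrow> 'n ipm_state" where
  "refresh S = S \<lparr>
     st_gamma_t := (\<chi> i. if i \<in> I_gamma S then st_gamma S $ i else st_gamma_t S $ i),
     st_theta_t := (\<chi> i. if i \<in> I_theta S then st_theta S $ i else st_theta_t S $ i),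
     st_phi_t := (\<chi> i. if i \<in> I_phi S then st_phi S $ i else st_phi_t S $ i),
     st_psi_t := (\<chi> i. if i \<in> I_psi S then st_psi S $ i else st_psi_t S $ i) \<rparr>"

definition rank1_update :: "'n \<Rightarrow> 'n::finite ipm_state \<Rightarrow> 'n ipm_state" where
  "rank1_update i S =
     (let d' = st_gamma_t S $ i / st_phi_t S $ i + st_theta_t S $ i / st_psi_t S $ i;
          \<Delta> = d' - st_d S $ i;
          M = st_M S
      in S \<lparr> st_M := M - (\<Delta> / (1 + \<Delta> * M $ i $ i)) *\<^sub>R
                        (\<chi> a b. column i M $ a * column i M $ b),
             st_d := (\<chi> j. if j = i then d' else st_d S $ j) \<rparr>)"

definition newton_step :: "'n::finite ipm_state \<Rightarrow> 'n ipm_state" where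
  "newton_step S =
     (let \<tau> = st_tau S;
          \<gamma> = st_gamma S; \<theta> = st_theta S; \<phi> = st_phi S; \<psi> = st_psi S;
          \<gamma>t = st_gamma_t S; \<theta>t = st_theta_t S; \<phi>t = st_phi_t S; \<psi>t = st_psi_t S;
          \<Delta>z = st_M S *v (\<chi> i. \<tau> * (1 / \<psi>t $ i) - \<tau> * (1 / \<phi>t $ i)
                                + \<gamma> $ i * \<phi> $ i / \<phi>t $ i - \<theta> $ i * \<psi> $ i / \<psi>t $ i);
          \<Delta>\<gamma> = (\<chi> i. \<gamma>t $ i / \<phi>t $ i * \<Delta>z $ i
                      + \<tau> * (1 / \<phi>t $ i) - \<gamma> $ i * \<phi> $ i / \<phi>t $ i);
          \<Delta>\<theta> = (\<chi> i. - (\<theta>t $ i / \<psi>t $ i) * \<Delta>z $ i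
                      + \<tau> * (1 / \<psi>t $ i) - \<theta> $ i * \<psi> $ i / \<psi>t $ i);
          \<Delta>\<phi> = - \<Delta>z;
          \<Delta>\<psi> = \<Delta>z
      in S \<lparr> st_z := st_z S + \<Delta>z,
             st_gamma := \<gamma> + \<Delta>\<gamma>, st_theta := \<theta> + \<Delta>\<theta>,
             st_phi := \<phi> + \<Delta>\<phi>, st_psi := \<psi> + \<Delta>\<psi>,
             st_tau := (1 - beta CARD('n) / sqrt (2 * real CARD('n))) * \<tau> \<rparr>)"

text \<open>
  The list \<open>us\<close> enumerates the indices of the rank-1 updates in the order in
  which they are performed.
\<close>
definition iteration :: "'n list \<Rightarrow> 'n::finite ipm_state \<Rightarrow> 'n ipm_state" where
  "iteration us S = newton_step (fold rank1_update us (refresh S))"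

text \<open>
  \<open>S k\<close> is the state at the beginning of iteration \<open>k\<close> (counted from 1), and
  \<open>us k\<close> lists the rank-1 updates of that iteration. The algorithm does not
  prescribe their order, so any repetition-free enumeration is admitted.
\<close>
definition algorithm_run ::
    "real ^ 'n ^ 'n \<Rightarrow> real ^ 'n \<Rightarrow> nat \<Rightarrow> (nat \<Rightarrow> 'n::finite ipm_state) \<Rightarrow> (nat \<Rightarrow> 'n list) \<Rightarrow> bool"
  where
  "algorithm_run H h N S us \<longleftrightarrow>
     S 1 = init_state H h \<and>
     (\<forall>k\<in>{1..N}.
        distinct (us k) \<and>
        set (us k) = I_gamma (S k) \<union> I_theta (S k) \<union> I_phi (S k) \<union> I_psi (S k) \<and>
        S (Suc k) = iteration (us k) (S k))"

lemma algorithm_run_exists: "\<exists>S us. algorithm_run H h N S us"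
proof -
  define I where "I S = I_gamma S \<union> I_theta S \<union> I_phi S \<union> I_psi S" for S :: "'a ipm_state"
  define e where "e S = (SOME xs. distinct xs \<and> set xs = I S)" for S :: "'a ipm_state"
  have e: "distinct (e S) \<and> set (e S) = I S" for S
    unfolding e_def by (rule someI_ex) (metis finite finite_distinct_list)
  define S where "S k = ((\<lambda>S. iteration (e S) S) ^^ (k - 1)) (init_state H h)" for k
  have "S (Suc k) = iteration (e (S k)) (S k)" if "1 \<le> k" for k
    using that by (cases k) (simp_all add: S_def)
  moreover have "S 1 = init_state H h" by (simp add: S_def)
  ultimately have "algorithm_run H h N S (\<lambda>k. e (S k))"
    using e unfolding algorithm_run_def I_def by auto
  then show ?thesis by blast
qed

end

theory Submission
  imports Defs
begin

text \<open>
  The proof bounds how far the iterates can travel. Measure the distance between two positive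
  vectors by the coordinatewise difference of logarithms. A copied entry becomes stale only when
  it differs from the true entry by more than the factor \<open>1 + \<delta>\<close>, so between two refreshes of the
  same copy the logarithm of the true entry has moved by more than \<open>ln (1 + \<delta>)\<close>. Hence the number of
  stale entries of one vector, over the whole run, is at most its total logarithmic movement
  divided by \<open>ln (1 + \<delta>)\<close> (\<open>card_stale_le_log_drift\<close>). The copies are exact at the start, so only the
  \<open>N - 1\<close> steps that precede the last test contribute.

  One Newton step moves little. If the complementarity products \<open>\<gamma> \<phi>\<close> and \<open>\<theta> \<psi>\<close> are within
  Euclidean distance \<open>\<alpha> \<tau>\<close> of \<open>\<tau> e\<close>, then the relative change of each of \<open>\<gamma>\<close>, \<open>\<theta>\<close>, \<open>\<phi>\<close>, \<open>\<psi>\<close> has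
  Euclidean norm at most \<open>\<eta> < 1\<close> (\<open>relative_step_bound\<close>). By Cauchy-Schwarz each of the four vectors
  moves by at most \<open>\<surd>n \<eta> / (1 - \<eta>)\<close> on the logarithmic scale (\<open>log_drift_le\<close>), and adding the four
  contributions gives the bound.

  It remains to see that this proximity persists (\<open>iteration_near_path\<close>). The step solves the
  Newton system linearized at the copies instead of the true iterates. Two error terms result: the
  discrepancy between copies and iterates, and the quadratic term of Newton's method. Both are
  controlled by a weighted energy of the step (\<open>weighted_newton_energy\<close>), which is where positive
  semidefiniteness of \<open>H\<close> enters. Together they are at most \<open>\<sigma> \<tau>\<close> (\<open>residual_bound\<close>), and \<open>\<beta>\<close> is
  chosen so that the reduction of \<open>\<tau>\<close> uses up exactly the remaining margin \<open>\<alpha> - \<sigma>\<close>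
  (\<open>beta_equation\<close>). The argument needs the step to be computed with the true inverse matrix, which
  the rank-one updates maintain by the Sherman-Morrison formula
  (\<open>rank_one_inverse_update\<close>, \<open>rank_one_pivot_positive\<close>).
\<close>

section \<open>Energy of an inexact Newton step\<close>

lemma abs_le_L2_set:
  assumes "finite J" "j \<in> J"
  shows "\<bar>f j\<bar> \<le> L2_set f J"
proof -
  have "\<bar>f j\<bar> \<le> L2_set (\<lambda>j. \<bar>f j\<bar>) J"
    using assms by (intro member_le_L2_set) auto
  then show ?thesis unfolding L2_set_def power2_abs .
qed

text \<open>
  Scale the linearized equation by the root of \<open>vt st\<close>. Its two terms become vectors \<open>p\<close> and \<open>q\<close> with
  \<open>p \<bullet> q = dv \<bullet> ds \<ge> 0\<close>, so \<open>\<parallel>p\<parallel>\<^sup>2 + \<parallel>q\<parallel>\<^sup>2 \<le> \<parallel>p + q\<parallel>\<^sup>2\<close>, and the right-hand side is the scaled residual.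
\<close>
lemma weighted_newton_energy:
  fixes v s vt st dv ds :: "'j \<Rightarrow> real"
  assumes J: "finite J" and m: "0 < m"
    and pos: "\<And>j. j \<in> J \<Longrightarrow> 0 < vt j" "\<And>j. j \<in> J \<Longrightarrow> 0 < st j"
    and lower: "\<And>j. j \<in> J \<Longrightarrow> m \<le> vt j * st j"
    and newton: "\<And>j. j \<in> J \<Longrightarrow> vt j * ds j + st j * dv j = \<tau> - v j * s j"
    and orth: "0 \<le> (\<Sum>j\<in>J. dv j * ds j)"
    and prox: "L2_set (\<lambda>j. v j * s j - \<tau>) J \<le> c"
  shows "(\<Sum>j\<in>J. vt j / st j * (ds j)\<^sup>2 + st j / vt j * (dv j)\<^sup>2) \<le> c\<^sup>2 / m"
proof -
  have "vt j / st j * (ds j)\<^sup>2 + st j / vt j * (dv j)\<^sup>2 + 2 * (dv j * ds j)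
      \<le> (v j * s j - \<tau>)\<^sup>2 / m" if "j \<in> J" for j
  proof -
    have p: "0 < vt j" "0 < st j" using pos that by auto
    have "vt j / st j * (ds j)\<^sup>2 + st j / vt j * (dv j)\<^sup>2 + 2 * (dv j * ds j)
        = (vt j * ds j + st j * dv j)\<^sup>2 / (vt j * st j)"
      using p by (simp add: field_simps power2_eq_square)
    also have "\<dots> = (v j * s j - \<tau>)\<^sup>2 / (vt j * st j)"
      using newton[OF that] by (simp add: power2_commute)
    also have "\<dots> \<le> (v j * s j - \<tau>)\<^sup>2 / m"
      using lower[OF that] m by (intro divide_left_mono mult_pos_pos) (auto simp: p)
    finally show ?thesis .
  qed
  then have "(\<Sum>j\<in>J. vt j / st j * (ds j)\<^sup>2 + st j / vt j * (dv j)\<^sup>2 + 2 * (dv j * ds j))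
      \<le> (\<Sum>j\<in>J. (v j * s j - \<tau>)\<^sup>2 / m)"
    by (rule sum_mono)
  also have "\<dots> = (L2_set (\<lambda>j. v j * s j - \<tau>) J)\<^sup>2 / m"
    by (simp add: L2_set_def sum_divide_distrib sum_nonneg)
  also have "\<dots> \<le> c\<^sup>2 / m"
    using m prox by (intro divide_right_mono power_mono) auto
  finally show ?thesis
    using orth by (simp add: sum.distrib flip: sum_distrib_left)
qed

text \<open>
  A primal-dual pair \<open>v\<close>, \<open>s\<close> near the central path at parameter \<open>\<tau>\<close>, with copies \<open>vt\<close>, \<open>st\<close> that agree
  up to the factor \<open>1 + \<delta>\<close>, and a step towards \<open>v s = \<tau>\<close> whose linearization uses the copies as
  coefficients. In the algorithm \<open>orth\<close> is convexity of the quadratic program.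
\<close>
locale inexact_newton =
  fixes J :: "'j set" and v s vt st dv ds :: "'j \<Rightarrow> real" and \<tau> a \<delta> :: real
  assumes finite_J: "finite J" and tau: "0 < \<tau>" and a: "0 \<le> a" "a < 1" and dl: "0 \<le> \<delta>"
    and pos: "\<And>j. j \<in> J \<Longrightarrow> 0 < v j" "\<And>j. j \<in> J \<Longrightarrow> 0 < s j"
    and close_v: "\<And>j. j \<in> J \<Longrightarrow> vt j \<le> (1 + \<delta>) * v j" "\<And>j. j \<in> J \<Longrightarrow> v j \<le> (1 + \<delta>) * vt j"
    and close_s: "\<And>j. j \<in> J \<Longrightarrow> st j \<le> (1 + \<delta>) * s j" "\<And>j. j \<in> J \<Longrightarrow> s j \<le> (1 + \<delta>) * st j"
    and newton: "\<And>j. j \<in> J \<Longrightarrow> vt j * ds j + st j * dv j = \<tau> - v j * s j"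
    and orth: "0 \<le> (\<Sum>j\<in>J. dv j * ds j)"
    and prox: "L2_set (\<lambda>j. v j * s j - \<tau>) J \<le> a * \<tau>"
begin

definition "energy j = vt j / st j * (ds j)\<^sup>2 + st j / vt j * (dv j)\<^sup>2"

lemma pos_t:
  assumes "j \<in> J"
  shows "0 < vt j" "0 < st j"
proof -
  have "0 < (1 + \<delta>) * vt j" "0 < (1 + \<delta>) * st j"
    using assms pos close_v(2) close_s(2) by (meson less_le_trans)+
  with dl show "0 < vt j" "0 < st j"
    by (simp_all add: zero_less_mult_iff)
qed

lemma product_bounds:
  assumes j: "j \<in> J"
  shows "(1 - a) * \<tau> / (1 + \<delta>)\<^sup>2 \<le> vt j * st j"
    and "vt j * st j \<le> (1 + \<delta>)\<^sup>2 * ((1 + a) * \<tau>)"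
proof -
  have "\<bar>v j * s j - \<tau>\<bar> \<le> a * \<tau>"
    using abs_le_L2_set[OF finite_J j, of "\<lambda>j. v j * s j - \<tau>"] prox by simp
  then have vs: "(1 - a) * \<tau> \<le> v j * s j" "v j * s j \<le> (1 + a) * \<tau>"
    by (simp_all add: abs_le_iff algebra_simps)
  have "v j * s j \<le> ((1 + \<delta>) * vt j) * ((1 + \<delta>) * st j)"
    using j close_v close_s pos pos_t dl by (intro mult_mono) (auto intro!: mult_nonneg_nonneg less_imp_le)
  then have "v j * s j \<le> (1 + \<delta>)\<^sup>2 * (vt j * st j)"
    by (simp add: power2_eq_square algebra_simps)
  with vs(1) dl show "(1 - a) * \<tau> / (1 + \<delta>)\<^sup>2 \<le> vt j * st j"
    by (simp add: divide_le_eq mult.commute)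
  have "vt j * st j \<le> ((1 + \<delta>) * v j) * ((1 + \<delta>) * s j)"
    using j close_v close_s pos pos_t dl by (intro mult_mono) (auto intro!: mult_nonneg_nonneg less_imp_le)
  also have "\<dots> = (1 + \<delta>)\<^sup>2 * (v j * s j)"
    by (simp add: power2_eq_square)
  also have "\<dots> \<le> (1 + \<delta>)\<^sup>2 * ((1 + a) * \<tau>)"
    using vs(2) by (intro mult_left_mono) auto
  finally show "vt j * st j \<le> (1 + \<delta>)\<^sup>2 * ((1 + a) * \<tau>)" .
qed

lemma lower_pos: "0 < (1 - a) * \<tau> / (1 + \<delta>)\<^sup>2"
  using a tau dl by simp

lemma energy_nonneg: "j \<in> J \<Longrightarrow> 0 \<le> energy j"
  using pos_t[of j] by (auto simp: energy_def)

text \<open>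
  The residual has norm at most \<open>a \<tau>\<close>, and the weights \<open>vt st\<close> are at least \<open>(1 - a) \<tau> / (1 + \<delta>)\<^sup>2\<close>.
\<close>
lemma energy_bound: "sum energy J \<le> (1 + \<delta>)\<^sup>2 * a\<^sup>2 / (1 - a) * \<tau>"
proof -
  have "sum energy J \<le> (a * \<tau>)\<^sup>2 / ((1 - a) * \<tau> / (1 + \<delta>)\<^sup>2)"
    unfolding energy_def
    by (rule weighted_newton_energy[OF finite_J lower_pos pos_t product_bounds(1) newton orth prox])
  also have "\<dots> = (1 + \<delta>)\<^sup>2 * a\<^sup>2 / (1 - a) * \<tau>"
    using a tau dl by (simp add: field_simps power2_eq_square)
  finally show ?thesis .
qed

text \<open>
  Passing from the energy to relative steps costs another factor \<open>1 / (vt st)\<close>, and replacing the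
  copy by the true entry in the denominator costs \<open>(1 + \<delta>)\<^sup>2\<close>. With the energy bound this makes the
  square of the stated constant, which is \<open>\<eta>\<close> for the parameters of the algorithm.
\<close>
lemma relative_step_bound:
  shows "L2_set (\<lambda>j. dv j / v j) J \<le> (1 + \<delta>) ^ 3 * a / (1 - a)"
    and "L2_set (\<lambda>j. ds j / s j) J \<le> (1 + \<delta>) ^ 3 * a / (1 - a)"
proof -
  let ?m = "(1 - a) * \<tau> / (1 + \<delta>)\<^sup>2"
  have nn: "0 \<le> (1 + \<delta>)\<^sup>2 / ?m"
    using lower_pos by (intro divide_nonneg_pos) auto
  \<comment> \<open>One estimate serves both halves of the pair, which play symmetric roles.\<close>
  have rel: "(d / x)\<^sup>2 \<le> (1 + \<delta>)\<^sup>2 / ?m * (y / xt * d\<^sup>2)"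
    if "0 < x" "0 < xt" "0 < y" "xt \<le> (1 + \<delta>) * x" "?m \<le> xt * y" for d x xt y
  proof -
    have "(d / x)\<^sup>2 \<le> ((1 + \<delta>) * (\<bar>d\<bar> / xt))\<^sup>2"
    proof (subst power2_abs[symmetric], rule power_mono)
      have "1 / x \<le> (1 + \<delta>) / xt" using that by (simp add: field_simps)
      from mult_left_mono[OF this, of "\<bar>d\<bar>"] that(1)
      show "\<bar>d / x\<bar> \<le> (1 + \<delta>) * (\<bar>d\<bar> / xt)" by (simp add: ac_simps)
    qed simp
    also have "\<dots> = (1 + \<delta>)\<^sup>2 / (xt * y) * (y / xt * d\<^sup>2)"
      using that by (simp add: field_simps power2_eq_square)
    also have "\<dots> \<le> (1 + \<delta>)\<^sup>2 / ?m * (y / xt * d\<^sup>2)"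
      using that lower_pos by (intro mult_right_mono divide_left_mono mult_pos_pos) auto
    finally show ?thesis .
  qed
  have fin: "L2_set f J \<le> (1 + \<delta>) ^ 3 * a / (1 - a)"
    if "\<And>j. j \<in> J \<Longrightarrow> (f j)\<^sup>2 \<le> (1 + \<delta>)\<^sup>2 / ?m * energy j" for f
  proof -
    have "(\<Sum>j\<in>J. (f j)\<^sup>2) \<le> (1 + \<delta>)\<^sup>2 / ?m * sum energy J"
      unfolding sum_distrib_left using that by (rule sum_mono)
    also have "\<dots> \<le> (1 + \<delta>)\<^sup>2 / ?m * ((1 + \<delta>)\<^sup>2 * a\<^sup>2 / (1 - a) * \<tau>)"
      using energy_bound nn by (rule mult_left_mono)
    also have "\<dots> = ((1 + \<delta>) ^ 3 * a / (1 - a))\<^sup>2"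
      using a tau dl by (simp add: divide_simps) (simp add: power2_eq_square power3_eq_cube)
    finally have "L2_set f J \<le> sqrt (((1 + \<delta>) ^ 3 * a / (1 - a))\<^sup>2)"
      unfolding L2_set_def by (rule real_sqrt_le_mono)
    then show ?thesis using a dl by simp
  qed
  have le1: "st j / vt j * (dv j)\<^sup>2 \<le> energy j" "vt j / st j * (ds j)\<^sup>2 \<le> energy j" if "j \<in> J" for j
    using pos_t[OF that] by (simp_all add: energy_def)
  show "L2_set (\<lambda>j. dv j / v j) J \<le> (1 + \<delta>) ^ 3 * a / (1 - a)"
  proof (rule fin)
    fix j assume j: "j \<in> J"
    have "(dv j / v j)\<^sup>2 \<le> (1 + \<delta>)\<^sup>2 / ?m * (st j / vt j * (dv j)\<^sup>2)"
      using j pos pos_t close_v product_bounds(1) by (intro rel) auto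
    also have "\<dots> \<le> (1 + \<delta>)\<^sup>2 / ?m * energy j"
      using le1(1)[OF j] nn by (rule mult_left_mono)
    finally show "(dv j / v j)\<^sup>2 \<le> (1 + \<delta>)\<^sup>2 / ?m * energy j" .
  qed
  show "L2_set (\<lambda>j. ds j / s j) J \<le> (1 + \<delta>) ^ 3 * a / (1 - a)"
  proof (rule fin)
    fix j assume j: "j \<in> J"
    have "(ds j / s j)\<^sup>2 \<le> (1 + \<delta>)\<^sup>2 / ?m * (vt j / st j * (ds j)\<^sup>2)"
      using j pos pos_t close_s product_bounds(1)[OF j] by (intro rel) (auto simp: mult.commute)
    also have "\<dots> \<le> (1 + \<delta>)\<^sup>2 / ?m * energy j"
      using le1(2)[OF j] nn by (rule mult_left_mono)
    finally show "(ds j / s j)\<^sup>2 \<le> (1 + \<delta>)\<^sup>2 / ?m * energy j" .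
  qed
qed

text \<open>
  Because the step satisfies the linearized equation exactly, the new residual is the sum of the
  coefficient error \<open>(v - vt) ds + (s - st) dv\<close> and the second-order term \<open>dv ds\<close>. The two summands of the
  constant, which is \<open>\<sigma>\<close> for the parameters of the algorithm, bound these two parts.
\<close>
lemma residual_bound:
  "L2_set (\<lambda>j. (v j + dv j) * (s j + ds j) - \<tau>) J
    \<le> (sqrt 2 * \<delta> * (1 + \<delta>)\<^sup>2 * a * sqrt ((1 + a) / (1 - a)) + (1 + \<delta>)\<^sup>2 * a\<^sup>2 / (2 * (1 - a))) * \<tau>"
proof -
  define F where "F j = (v j - vt j) * ds j + (s j - st j) * dv j" for j
  let ?M = "(1 + \<delta>)\<^sup>2 * ((1 + a) * \<tau>)"
  \<comment> \<open>The error relative to the copy is at most \<open>\<delta>\<close>: above by closeness, below since \<open>1 - 1 / (1 + \<delta>) \<le> \<delta>\<close>.\<close>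
  have dev: "\<bar>x - xt\<bar> \<le> \<delta> * xt" if "0 < x" "xt \<le> (1 + \<delta>) * x" "x \<le> (1 + \<delta>) * xt" "0 < xt" for x xt
  proof -
    have "xt \<le> x + \<delta> * x" using that(2) by (simp add: algebra_simps)
    moreover have "x \<le> xt + \<delta> * xt" using that(3) by (simp add: algebra_simps)
    moreover have "\<delta> * x \<le> \<delta> * xt" if "x \<le> xt" using that dl by (rule mult_left_mono)
    moreover have "0 \<le> \<delta> * xt" using dl that by simp
    ultimately show ?thesis by (cases "x \<le> xt") auto
  qed
  have F: "(F j)\<^sup>2 \<le> 2 * \<delta>\<^sup>2 * ?M * energy j" if j: "j \<in> J" for j
  proof -
    have p: "0 < vt j" "0 < st j" using pos_t j by auto
    have "\<bar>F j\<bar> \<le> \<bar>v j - vt j\<bar> * \<bar>ds j\<bar> + \<bar>s j - st j\<bar> * \<bar>dv j\<bar>"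
      unfolding F_def by (metis abs_mult abs_triangle_ineq)
    also have "\<dots> \<le> \<delta> * vt j * \<bar>ds j\<bar> + \<delta> * st j * \<bar>dv j\<bar>"
      using j pos close_v close_s p by (intro add_mono mult_right_mono dev) auto
    finally have "(F j)\<^sup>2 \<le> (\<delta> * vt j * \<bar>ds j\<bar> + \<delta> * st j * \<bar>dv j\<bar>)\<^sup>2"
      by (rule abs_le_square_iff[THEN iffD1, OF order_trans[OF _ abs_ge_self]])
    also have "\<dots> \<le> 2 * ((\<delta> * vt j * \<bar>ds j\<bar>)\<^sup>2 + (\<delta> * st j * \<bar>dv j\<bar>)\<^sup>2)"
      using sum_squares_bound[of "\<delta> * vt j * \<bar>ds j\<bar>" "\<delta> * st j * \<bar>dv j\<bar>"]
      by (simp add: power2_sum)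
    also have "\<dots> = 2 * \<delta>\<^sup>2 * (vt j * st j) * energy j"
      using p by (simp add: energy_def power_mult_distrib) (simp add: field_simps power2_eq_square)
    also have "\<dots> \<le> 2 * \<delta>\<^sup>2 * ?M * energy j"
      using product_bounds(2)[OF j] energy_nonneg[OF j] by (intro mult_right_mono mult_left_mono) auto
    finally show ?thesis .
  qed
  have "(\<Sum>j\<in>J. (F j)\<^sup>2) \<le> 2 * \<delta>\<^sup>2 * ?M * sum energy J"
    unfolding sum_distrib_left using F by (rule sum_mono)
  also have "\<dots> \<le> 2 * \<delta>\<^sup>2 * ?M * ((1 + \<delta>)\<^sup>2 * a\<^sup>2 / (1 - a) * \<tau>)"
    using energy_bound a tau by (intro mult_left_mono) auto
  also have "\<dots> = 2 * ((\<delta> * (1 + \<delta>)\<^sup>2 * a * \<tau>)\<^sup>2 * ((1 + a) / (1 - a)))"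
    by (simp add: power_mult_distrib power2_eq_square)
  finally have "L2_set F J \<le> sqrt (2 * ((\<delta> * (1 + \<delta>)\<^sup>2 * a * \<tau>)\<^sup>2 * ((1 + a) / (1 - a))))"
    unfolding L2_set_def by (rule real_sqrt_le_mono)
  also have "\<dots> = sqrt 2 * \<delta> * (1 + \<delta>)\<^sup>2 * a * sqrt ((1 + a) / (1 - a)) * \<tau>"
    using a dl tau by (subst real_sqrt_mult, subst real_sqrt_mult) (simp add: abs_mult)
  finally have 1: "L2_set F J \<le> \<dots>" .
  have "L2_set (\<lambda>j. dv j * ds j) J \<le> (\<Sum>j\<in>J. \<bar>dv j * ds j\<bar>)"
    by (rule L2_set_le_sum_abs)
  also have "\<dots> \<le> (\<Sum>j\<in>J. energy j / 2)"
  proof (rule sum_mono)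
    fix j assume j: "j \<in> J"
    have p: "0 < vt j" "0 < st j" using pos_t j by auto
    have "energy j - 2 * \<bar>dv j * ds j\<bar> = (vt j * \<bar>ds j\<bar> - st j * \<bar>dv j\<bar>)\<^sup>2 / (vt j * st j)"
      using p by (simp add: energy_def abs_mult power2_diff power_mult_distrib)
         (simp add: field_simps power2_eq_square)
    also have "\<dots> \<ge> 0" using p by simp
    finally show "\<bar>dv j * ds j\<bar> \<le> energy j / 2" by simp
  qed
  also have "\<dots> = sum energy J / 2" by (simp add: sum_divide_distrib)
  also have "\<dots> \<le> ((1 + \<delta>)\<^sup>2 * a\<^sup>2 / (1 - a) * \<tau>) / 2"
    using energy_bound by (rule divide_right_mono) simp
  also have "\<dots> = (1 + \<delta>)\<^sup>2 * a\<^sup>2 / (2 * (1 - a)) * \<tau>"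
    by (simp add: divide_simps)
  finally have 2: "L2_set (\<lambda>j. dv j * ds j) J \<le> \<dots>" .
  have "L2_set (\<lambda>j. (v j + dv j) * (s j + ds j) - \<tau>) J = L2_set (\<lambda>j. F j + dv j * ds j) J"
  proof (rule L2_set_cong)
    fix j assume "j \<in> J"
    from newton[OF this] show "(v j + dv j) * (s j + ds j) - \<tau> = F j + dv j * ds j"
      unfolding F_def by (simp add: algebra_simps)
  qed simp
  also have "\<dots> \<le> L2_set F J + L2_set (\<lambda>j. dv j * ds j) J"
    by (rule L2_set_triangle_ineq)
  finally show ?thesis using 1 2 by (simp add: algebra_simps)
qed

end

section \<open>Rank-one updates of the inverse\<close>

lemma diag_mult_component: "((G + diag d) *v x) $ i = (G *v x) $ i + d $ i * x $ i"
  by (simp add: matrix_vector_mult_add_rdistrib)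
     (simp add: matrix_vector_mult_def diag_def if_distrib if_distribR cong: if_cong)

lemma inner_psd_plus_diag:
  "x \<bullet> ((G + diag d) *v x) = x \<bullet> (G *v x) + (\<Sum>i\<in>UNIV. d $ i * (x $ i)\<^sup>2)"
  by (simp add: inner_vec_def diag_mult_component distrib_left sum.distrib power2_eq_square ac_simps)

lemma symmetric_inverse_psd_plus_diag:
  fixes G :: "real ^ 'n ^ 'n"
  assumes sym: "transpose G = G" and psd: "\<forall>x. 0 \<le> x \<bullet> (G *v x)" and d: "\<forall>i. 0 < d $ i"
  shows "(G + diag d) ** matrix_inv (G + diag d) = mat 1"
    and "transpose (matrix_inv (G + diag d)) = matrix_inv (G + diag d)"
proof -
  let ?A = "G + diag d" and ?M = "matrix_inv (G + diag d)"
  have "x = 0" if "?A *v x = 0" for x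
  proof -
    have nn: "0 \<le> d $ i * (x $ i)\<^sup>2" for i using d by (simp add: less_imp_le)
    have "x \<bullet> (G *v x) + (\<Sum>i\<in>UNIV. d $ i * (x $ i)\<^sup>2) = 0"
      using that by (simp flip: inner_psd_plus_diag)
    moreover have "0 \<le> (\<Sum>i\<in>UNIV. d $ i * (x $ i)\<^sup>2)" by (intro sum_nonneg nn)
    ultimately have "(\<Sum>i\<in>UNIV. d $ i * (x $ i)\<^sup>2) = 0" using psd[rule_format, of x] by linarith
    then have "\<forall>i. d $ i * (x $ i)\<^sup>2 = 0" using nn by (simp add: sum_nonneg_eq_0_iff)
    then show "x = 0" using d by (auto simp: vec_eq_iff less_le)
  qed
  then have "invertible ?A"
    unfolding invertible_left_inverse matrix_left_invertible_ker by blast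
  then have inv: "?A ** ?M = mat 1 \<and> ?M ** ?A = mat 1"
    unfolding invertible_def matrix_inv_def by (rule someI_ex)
  then show 1: "?A ** ?M = mat 1" ..
  have "transpose ?A = ?A"
    using sym by (auto simp: vec_eq_iff transpose_def diag_def)
  then have "transpose ?M ** ?A = mat 1"
    by (metis 1 matrix_transpose_mul transpose_mat)
  then show "transpose ?M = ?M"
    by (metis 1 matrix_mul_assoc matrix_mul_lid matrix_mul_rid)
qed

text \<open>
  The Sherman-Morrison formula. Since the correction is built from a column of \<open>M\<close> only, where the
  general formula has a column and a row, symmetry of \<open>M\<close> is required and has to be carried along.
\<close>
lemma rank_one_inverse_update:
  fixes A M :: "real ^ 'n ^ 'n"
  assumes inv: "A ** M = mat 1" and sym: "transpose M = M" and piv: "1 + \<Delta> * M $ i $ i \<noteq> 0"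
  defines "M' \<equiv> M - (\<Delta> / (1 + \<Delta> * M $ i $ i)) *\<^sub>R (\<chi> a b. column i M $ a * column i M $ b)"
  shows "(A + diag (\<chi> j. if j = i then \<Delta> else 0)) ** M' = mat 1" and "transpose M' = M'"
proof -
  define c where "c = \<Delta> / (1 + \<Delta> * M $ i $ i)"
  have M': "M' $ k $ b = M $ k $ b - c * (M $ k $ i * M $ b $ i)" for k b
    by (simp add: M'_def column_def c_def)
  have symM: "M $ k $ b = M $ b $ k" for k b
    using arg_cong[OF sym, of "\<lambda>X. X $ b $ k"] by (simp add: transpose_def)
  have AM: "(\<Sum>k\<in>UNIV. A $ a $ k * M $ k $ b) = (if a = b then 1 else 0)" for a b
    using arg_cong[OF inv, of "\<lambda>X. X $ a $ b"] by (simp add: matrix_matrix_mult_def mat_def)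
  have E: "diag (\<chi> j. if j = i then \<Delta> else 0) $ a $ k = (if a = k then (if a = i then \<Delta> else 0) else 0)" for a k
    by (simp add: diag_def)
  have "((A + diag (\<chi> j. if j = i then \<Delta> else 0)) ** M') $ a $ b = (mat 1 :: real ^ 'n ^ 'n) $ a $ b" for a b
  proof -
    have "((A + diag (\<chi> j. if j = i then \<Delta> else 0)) ** M') $ a $ b
        = (\<Sum>k\<in>UNIV. A $ a $ k * M' $ k $ b) + (\<Sum>k\<in>UNIV. (if a = k then (if a = i then \<Delta> else 0) else 0) * M' $ k $ b)"
      by (simp add: matrix_matrix_mult_def E distrib_right sum.distrib)
    also have "(\<Sum>k\<in>UNIV. (if a = k then (if a = i then \<Delta> else 0) else 0) * M' $ k $ b)
        = (\<Sum>k\<in>UNIV. if a = k then (if a = i then \<Delta> * M' $ i $ b else 0) else 0)"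
      by (intro sum.cong) auto
    also have "\<dots> = (if a = i then \<Delta> * M' $ i $ b else 0)"
      by simp
    also have "(\<Sum>k\<in>UNIV. A $ a $ k * M' $ k $ b)
        = (\<Sum>k\<in>UNIV. A $ a $ k * M $ k $ b) - c * M $ b $ i * (\<Sum>k\<in>UNIV. A $ a $ k * M $ k $ i)"
      unfolding sum_distrib_left by (simp add: M' right_diff_distrib sum_subtractf ac_simps)
    also have "\<dots> = (if a = b then 1 else 0) - c * M $ b $ i * (if a = i then 1 else 0)"
      unfolding AM ..
    finally have "((A + diag (\<chi> j. if j = i then \<Delta> else 0)) ** M') $ a $ b
        = (if a = b then 1 else 0) - c * M $ b $ i * (if a = i then 1 else 0)
          + (if a = i then \<Delta> * M' $ i $ b else 0)" .
    moreover have "\<Delta> * M' $ i $ b = c * M $ b $ i"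
    proof -
      have "\<Delta> - \<Delta> * c * M $ i $ i = c"
        using piv by (simp add: c_def field_simps)
      moreover have "\<Delta> * M' $ i $ b = (\<Delta> - \<Delta> * c * M $ i $ i) * M $ b $ i"
        using symM[of i b] by (simp add: M' algebra_simps)
      ultimately show ?thesis by simp
    qed
    ultimately show ?thesis by (simp add: mat_def)
  qed
  then show "(A + diag (\<chi> j. if j = i then \<Delta> else 0)) ** M' = mat 1"
    by (simp add: vec_eq_iff)
  show "transpose M' = M'"
    using symM by (auto simp: vec_eq_iff transpose_def M' mult.commute)
qed

text \<open>
  The update never divides by zero, even when the diagonal entry decreases. With \<open>x = M e\<^sub>i\<close>, pairing
  \<open>(G + diag d) x = e\<^sub>i\<close> with \<open>x\<close> yields \<open>d\<^sub>i x\<^sub>i\<^sup>2 \<le> x\<^sub>i\<close>, whence \<open>0 \<le> d\<^sub>i M\<^sub>i\<^sub>i \<le> 1\<close>, and the pivot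
  \<open>1 - d\<^sub>i M\<^sub>i\<^sub>i + d' M\<^sub>i\<^sub>i\<close> is positive.
\<close>
lemma rank_one_pivot_positive:
  fixes G M :: "real ^ 'n ^ 'n"
  assumes psd: "\<forall>x. 0 \<le> x \<bullet> (G *v x)" and d: "\<forall>i. 0 < d $ i"
    and inv: "(G + diag d) ** M = mat 1" and d': "0 < d'"
  shows "0 < 1 + (d' - d $ i) * M $ i $ i"
proof -
  define x where "x = M *v axis i 1"
  have xi: "x $ i = M $ i $ i"
    by (simp add: x_def matrix_vector_mult_basis column_def)
  have "(G + diag d) *v x = axis i 1"
    by (simp add: x_def matrix_vector_mul_assoc inv)
  then have "x $ i = x \<bullet> (G *v x) + (\<Sum>j\<in>UNIV. d $ j * (x $ j)\<^sup>2)"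
    by (metis inner_psd_plus_diag inner_axis inner_real_def mult.right_neutral)
  moreover have "d $ i * (x $ i)\<^sup>2 \<le> (\<Sum>j\<in>UNIV. d $ j * (x $ j)\<^sup>2)"
    using d by (intro member_le_sum) (auto simp: less_imp_le)
  ultimately have *: "d $ i * (x $ i)\<^sup>2 \<le> x $ i" using psd[rule_format, of x] by linarith
  have "0 \<le> d $ i * (x $ i)\<^sup>2" using d by (simp add: less_imp_le)
  with * have x0: "0 \<le> x $ i" by linarith
  show ?thesis
  proof (cases "x $ i = 0")
    case False
    with x0 have p: "0 < x $ i" by simp
    with * have "d $ i * x $ i \<le> 1"
      by (simp add: power2_eq_square flip: mult.assoc)
    moreover have "0 < d' * x $ i" using p d' by simp
    ultimately show ?thesis by (simp add: xi left_diff_distrib)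
  qed (simp add: xi)
qed

text \<open>
  The diagonal prescribed by the current copies, as opposed to \<open>st_d\<close>, the diagonal for which \<open>st_M\<close> is
  the inverse. The two differ between a refresh and the end of the rank-one updates.
\<close>
definition diagonal :: "'n::finite ipm_state \<Rightarrow> real ^ 'n" where
  "diagonal S = (\<chi> i. st_gamma_t S $ i / st_phi_t S $ i + st_theta_t S $ i / st_psi_t S $ i)"

definition maintains_inverse :: "real ^ 'n ^ 'n \<Rightarrow> 'n::finite ipm_state \<Rightarrow> bool" where
  "maintains_inverse G S \<longleftrightarrow> (\<forall>i. 0 < st_d S $ i) \<and>
     (G + diag (st_d S)) ** st_M S = mat 1 \<and> transpose (st_M S) = st_M S"

lemma rank1_update_sel [simp]:
  "st_tau (rank1_update i S) = st_tau S"
  "st_gamma (rank1_update i S) = st_gamma S" "st_theta (rank1_update i S) = st_theta S"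
  "st_phi (rank1_update i S) = st_phi S" "st_psi (rank1_update i S) = st_psi S"
  "st_gamma_t (rank1_update i S) = st_gamma_t S" "st_theta_t (rank1_update i S) = st_theta_t S"
  "st_phi_t (rank1_update i S) = st_phi_t S" "st_psi_t (rank1_update i S) = st_psi_t S"
  "st_d (rank1_update i S) = (\<chi> j. if j = i then diagonal S $ j else st_d S $ j)"
  by (simp_all add: rank1_update_def Let_def diagonal_def vec_eq_iff)

lemma diagonal_rank1_update [simp]: "diagonal (rank1_update i S) = diagonal S"
  by (simp add: diagonal_def)

lemma fold_rank1_update_sel [simp]:
  "st_tau (fold rank1_update us S) = st_tau S"
  "st_gamma (fold rank1_update us S) = st_gamma S" "st_theta (fold rank1_update us S) = st_theta S"
  "st_phi (fold rank1_update us S) = st_phi S" "st_psi (fold rank1_update us S) = st_psi S"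
  "st_gamma_t (fold rank1_update us S) = st_gamma_t S" "st_theta_t (fold rank1_update us S) = st_theta_t S"
  "st_phi_t (fold rank1_update us S) = st_phi_t S" "st_psi_t (fold rank1_update us S) = st_psi_t S"
  by (induction us arbitrary: S) simp_all

lemma diagonal_fold_rank1_update [simp]: "diagonal (fold rank1_update us S) = diagonal S"
  by (simp add: diagonal_def)

lemma st_d_fold_rank1_update:
  "st_d (fold rank1_update us S) = (\<chi> j. if j \<in> set us then diagonal S $ j else st_d S $ j)"
  by (induction us arbitrary: S) (auto simp: vec_eq_iff)

lemma maintains_inverse_rank1_update:
  assumes psd: "\<forall>x. 0 \<le> x \<bullet> (G *v x)" and S: "maintains_inverse G S" and pos: "\<forall>i. 0 < diagonal S $ i"
  shows "maintains_inverse G (rank1_update i S)"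
proof -
  define \<Delta> where "\<Delta> = diagonal S $ i - st_d S $ i"
  have M: "st_M (rank1_update i S) = st_M S - (\<Delta> / (1 + \<Delta> * st_M S $ i $ i)) *\<^sub>R
             (\<chi> a b. column i (st_M S) $ a * column i (st_M S) $ b)"
    by (simp add: rank1_update_def Let_def \<Delta>_def diagonal_def)
  have S': "\<forall>i. 0 < st_d S $ i" "(G + diag (st_d S)) ** st_M S = mat 1" "transpose (st_M S) = st_M S"
    using S by (auto simp: maintains_inverse_def)
  have "1 + \<Delta> * st_M S $ i $ i \<noteq> 0"
    using rank_one_pivot_positive[OF psd S'(1,2), of "diagonal S $ i" i] pos by (simp add: \<Delta>_def)
  note upd = rank_one_inverse_update[OF S'(2,3) this, folded M]
  have "diag (st_d (rank1_update i S)) = diag (st_d S) + diag (\<chi> j. if j = i then \<Delta> else 0)"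
    by (simp add: diag_def vec_eq_iff \<Delta>_def)
  with upd S'(1) pos show ?thesis by (simp add: maintains_inverse_def add.assoc)
qed

lemma maintains_inverse_fold:
  assumes psd: "\<forall>x. 0 \<le> x \<bullet> (G *v x)" and "maintains_inverse G S" and "\<forall>i. 0 < diagonal S $ i"
  shows "maintains_inverse G (fold rank1_update us S)"
  using assms(2,3) by (induction us arbitrary: S) (simp_all add: maintains_inverse_rank1_update[OF psd])

section \<open>Numerical properties of the parameters\<close>

lemma alpha_delta_bounds: "0 < alpha" "alpha < 1" "0 < delta"
  by (simp_all add: alpha_def delta_def)

lemma eta_bounds: "0 < eta" "eta < 1"
  by (simp_all add: eta_def alpha_def delta_def power3_eq_cube)

lemma sigma_bounds: "0 < sigma" "sigma < alpha"
proof -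
  show "0 < sigma"
    by (simp add: sigma_def alpha_def delta_def add_pos_pos)
  have "sqrt 2 * sqrt (13 / 7) \<le> (2 :: real)"
    unfolding real_sqrt_mult[symmetric] by (rule real_le_lsqrt) simp_all
  then show "sigma < alpha"
    by (simp add: sigma_def alpha_def delta_def power2_eq_square)
qed

lemma beta_bounds: "0 < beta n" "beta n < 1"
proof -
  have "0 \<le> alpha / sqrt (2 * real n)" using alpha_delta_bounds by simp
  then have *: "1 \<le> 1 + alpha / sqrt (2 * real n)" by simp
  with sigma_bounds show "0 < beta n"
    unfolding beta_def by (intro divide_pos_pos; linarith)
  have "alpha - sigma \<le> (alpha - sigma) * (1 + alpha / sqrt (2 * real n))"
    using mult_left_mono[OF *, of "alpha - sigma"] sigma_bounds by simp
  then have "beta n \<le> alpha - sigma"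
    unfolding beta_def using * by (subst pos_divide_le_eq; linarith)
  also have "\<dots> < 1" using sigma_bounds alpha_delta_bounds by simp
  finally show "beta n < 1" .
qed

lemma shrink_bounds:
  assumes "0 < n"
  shows "0 < beta n / sqrt (2 * real n)" "beta n / sqrt (2 * real n) < 1"
proof -
  have q: "1 \<le> sqrt (2 * real n)" using assms by simp
  then have "beta n < sqrt (2 * real n)" using beta_bounds(2)[of n] by linarith
  moreover have "0 < sqrt (2 * real n)" using q by linarith
  ultimately show "0 < beta n / sqrt (2 * real n)" "beta n / sqrt (2 * real n) < 1"
    using beta_bounds(1)[of n] by simp_all
qed

lemma N_iter_pos:
  assumes "0 < n" "0 < \<epsilon>" "\<epsilon> < 2 * real n + alpha * sqrt (2 * real n)"
  shows "1 \<le> N_iter n \<epsilon>"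
proof -
  let ?b = "beta n / sqrt (2 * real n)"
  have "1 < (2 * real n + alpha * sqrt (2 * real n)) / \<epsilon>" using assms by simp
  then have "0 < ln ((2 * real n + alpha * sqrt (2 * real n)) / \<epsilon>)" by (rule ln_gt_zero)
  moreover have "0 < - ln (1 - ?b)" using shrink_bounds[OF assms(1)] by simp
  ultimately have "0 < ln ((2 * real n + alpha * sqrt (2 * real n)) / \<epsilon>) / (- ln (1 - ?b))"
    by (rule divide_pos_pos)
  then show ?thesis unfolding N_iter_def by linarith
qed

text \<open>
  The defining property of \<open>\<beta>\<close>: lowering \<open>\<tau>\<close> by the factor \<open>1 - \<beta> / \<surd>(2 n)\<close> moves the target \<open>\<tau> e\<close>, a vector
  with \<open>2 n\<close> entries, by \<open>\<beta> \<tau>\<close>. The residual \<open>\<sigma> \<tau>\<close> left by the Newton step plus this displacement is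
  exactly \<open>\<alpha>\<close> times the new \<open>\<tau>\<close>.
\<close>
lemma beta_equation:
  assumes "0 < n"
  shows "sigma + beta n / sqrt (2 * real n) * sqrt (2 * real n)
    = alpha * (1 - beta n / sqrt (2 * real n))"
proof -
  define q where "q = sqrt (2 * real n)"
  have q: "0 < q" using assms by (simp add: q_def)
  have "0 < 1 + alpha / q" using q alpha_delta_bounds by (simp add: add_pos_pos)
  then have "beta n * (1 + alpha / q) = alpha - sigma"
    by (simp add: beta_def flip: q_def)
  then have "sigma + beta n = alpha * (1 - beta n / q)"
    using q by (simp add: algebra_simps)
  then show ?thesis using q by (simp flip: q_def)
qed

section \<open>Persistence of proximity to the central path\<close>

definition renew :: "real ^ 'n \<Rightarrow> real ^ 'n \<Rightarrow> real ^ 'n" where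
  "renew xt x = (\<chi> i. if i \<in> stale xt x then x $ i else xt $ i)"

lemma refresh_sel [simp]:
  "st_tau (refresh S) = st_tau S"
  "st_gamma (refresh S) = st_gamma S" "st_theta (refresh S) = st_theta S"
  "st_phi (refresh S) = st_phi S" "st_psi (refresh S) = st_psi S"
  "st_gamma_t (refresh S) = renew (st_gamma_t S) (st_gamma S)"
  "st_theta_t (refresh S) = renew (st_theta_t S) (st_theta S)"
  "st_phi_t (refresh S) = renew (st_phi_t S) (st_phi S)"
  "st_psi_t (refresh S) = renew (st_psi_t S) (st_psi S)"
  "st_d (refresh S) = st_d S" "st_M (refresh S) = st_M S"
  by (simp_all add: refresh_def renew_def I_gamma_def I_theta_def I_phi_def I_psi_def)

lemma renew_close:
  assumes x: "0 < x $ i" and xt: "0 < xt $ i"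
  shows "0 < renew xt x $ i" "renew xt x $ i \<le> (1 + delta) * x $ i" "x $ i \<le> (1 + delta) * renew xt x $ i"
proof -
  have d: "0 < 1 + delta" using alpha_delta_bounds by simp
  have *: "xt $ i \<le> (1 + delta) * x $ i \<and> x $ i \<le> (1 + delta) * xt $ i" if "i \<notin> stale xt x"
    using that x xt d by (auto simp: stale_def divide_simps mult.commute)
  have "x $ i \<le> (1 + delta) * x $ i" using x alpha_delta_bounds by simp
  with * x xt show "0 < renew xt x $ i" "renew xt x $ i \<le> (1 + delta) * x $ i"
      "x $ i \<le> (1 + delta) * renew xt x $ i"
    by (auto simp: renew_def)
qed

text \<open>
  Stacking \<open>\<gamma>\<close> over \<open>\<theta>\<close> and \<open>\<phi>\<close> over \<open>\<psi>\<close> turns the optimality system into a single complementarity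
  condition with \<open>2 n\<close> entries, indexed by the sum type.
\<close>
definition dual :: "'n::finite ipm_state \<Rightarrow> 'n + 'n \<Rightarrow> real" where
  "dual S = case_sum (($) (st_gamma S)) (($) (st_theta S))"
definition slack :: "'n::finite ipm_state \<Rightarrow> 'n + 'n \<Rightarrow> real" where
  "slack S = case_sum (($) (st_phi S)) (($) (st_psi S))"
definition dual_t :: "'n::finite ipm_state \<Rightarrow> 'n + 'n \<Rightarrow> real" where
  "dual_t S = case_sum (($) (st_gamma_t S)) (($) (st_theta_t S))"
definition slack_t :: "'n::finite ipm_state \<Rightarrow> 'n + 'n \<Rightarrow> real" where
  "slack_t S = case_sum (($) (st_phi_t S)) (($) (st_psi_t S))"

lemmas stacked_defs = dual_def slack_def dual_t_def slack_t_def

lemma all_sum_type: "(\<forall>j. P j) \<longleftrightarrow> (\<forall>i. P (Inl i)) \<and> (\<forall>i. P (Inr i))"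
  by (metis sum.exhaust)

lemma sum_UNIV_sum_type:
  "(\<Sum>j\<in>(UNIV :: ('a::finite + 'b::finite) set). f j) = (\<Sum>i\<in>UNIV. f (Inl i)) + (\<Sum>i\<in>UNIV. f (Inr i))"
  by (simp add: sum.Plus flip: UNIV_Plus_UNIV)

text \<open>
  The computed direction solves the Newton system at the copies. The second claim is monotonicity:
  \<open>\<Delta>\<theta> - \<Delta>\<gamma> = G \<Delta>z\<close>, so the inner product of the two directions is the quadratic form of \<open>G\<close> at \<open>\<Delta>z\<close>.
\<close>
lemma newton_step_equations:
  fixes S :: "'n::finite ipm_state"
  assumes psd: "\<forall>x. 0 \<le> x \<bullet> (G *v x)"
    and inv: "(G + diag (diagonal S)) ** st_M S = mat 1"
    and pos: "\<forall>j. 0 < slack_t S j"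
  defines "dv \<equiv> \<lambda>j. dual (newton_step S) j - dual S j"
    and "ds \<equiv> \<lambda>j. slack (newton_step S) j - slack S j"
  shows "dual_t S j * ds j + slack_t S j * dv j = st_tau S - dual S j * slack S j"
    and "0 \<le> (\<Sum>j\<in>UNIV. dv j * ds j)"
proof -
  define w :: "real ^ 'n" where "w = (\<chi> i. st_tau S * (1 / st_psi_t S $ i) - st_tau S * (1 / st_phi_t S $ i)
        + st_gamma S $ i * st_phi S $ i / st_phi_t S $ i - st_theta S $ i * st_psi S $ i / st_psi_t S $ i)"
  define z where "z = st_M S *v w"
  have dv: "dv (Inl i) = st_gamma_t S $ i / st_phi_t S $ i * z $ i
              + st_tau S * (1 / st_phi_t S $ i) - st_gamma S $ i * st_phi S $ i / st_phi_t S $ i"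
           "dv (Inr i) = - (st_theta_t S $ i / st_psi_t S $ i) * z $ i
              + st_tau S * (1 / st_psi_t S $ i) - st_theta S $ i * st_psi S $ i / st_psi_t S $ i" for i
    by (simp_all add: dv_def dual_def newton_step_def Let_def z_def w_def)
  have ds: "ds (Inl i) = - z $ i" "ds (Inr i) = z $ i" for i
    by (simp_all add: ds_def slack_def newton_step_def Let_def z_def w_def)
  have pos': "0 < st_phi_t S $ i" "0 < st_psi_t S $ i" for i
    using pos[rule_format, of "Inl i"] pos[rule_format, of "Inr i"] by (simp_all add: slack_t_def)
  show "dual_t S j * ds j + slack_t S j * dv j = st_tau S - dual S j * slack S j"
  proof (cases j)
    case (Inl i)
    then show ?thesis using pos'(1)[of i] by (simp add: stacked_defs dv ds) (simp add: field_simps)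
  next
    case (Inr i)
    then show ?thesis using pos'(2)[of i] by (simp add: stacked_defs dv ds) (simp add: field_simps)
  qed
  have "(G + diag (diagonal S)) *v z = w"
    by (simp add: z_def matrix_vector_mul_assoc inv)
  then have "(G *v z) $ i = w $ i - diagonal S $ i * z $ i" for i
    by (metis diag_mult_component add_diff_cancel_right')
  moreover have "w $ i - diagonal S $ i * z $ i = dv (Inr i) - dv (Inl i)" for i
    by (simp add: dv w_def diagonal_def algebra_simps)
  ultimately have Gz: "(G *v z) $ i = dv (Inr i) - dv (Inl i)" for i by simp
  have "(\<Sum>j\<in>UNIV. dv j * ds j) = (\<Sum>i\<in>UNIV. z $ i * (dv (Inr i) - dv (Inl i)))"
    by (simp add: sum_UNIV_sum_type ds right_diff_distrib sum_subtractf sum_negf mult.commute)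
  also have "\<dots> = z \<bullet> (G *v z)" by (simp add: inner_vec_def Gz)
  finally show "0 \<le> (\<Sum>j\<in>UNIV. dv j * ds j)" using psd by simp
qed

lemma newton_step_sel [simp]:
  "st_tau (newton_step S) = (1 - beta CARD('n) / sqrt (2 * real CARD('n))) * st_tau S"
  "st_gamma_t (newton_step S) = st_gamma_t S" "st_theta_t (newton_step S) = st_theta_t S"
  "st_phi_t (newton_step S) = st_phi_t S" "st_psi_t (newton_step S) = st_psi_t S"
  "st_d (newton_step S) = st_d S" "st_M (newton_step S) = st_M S"
  for S :: "'n::finite ipm_state"
  by (simp_all add: newton_step_def Let_def)

text \<open>
  The loop invariant. It holds at the beginning of an iteration, before the refresh, so it says nothing
  about how close the copies are; their positivity keeps the prescribed diagonal positive.
\<close>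
definition near_path :: "real ^ 'n ^ 'n \<Rightarrow> 'n::finite ipm_state \<Rightarrow> bool" where
  "near_path G S \<longleftrightarrow> 0 < st_tau S \<and> (\<forall>j. 0 < dual S j) \<and> (\<forall>j. 0 < slack S j) \<and>
     (\<forall>j. 0 < dual_t S j) \<and> (\<forall>j. 0 < slack_t S j) \<and>
     st_d S = diagonal S \<and> maintains_inverse G S \<and>
     L2_set (\<lambda>j. dual S j * slack S j - st_tau S) UNIV \<le> alpha * st_tau S"

lemma positive_if_relative_step_small:
  fixes x y :: "'a::finite \<Rightarrow> real"
  assumes "0 < x j" and "L2_set (\<lambda>j. (y j - x j) / x j) UNIV < 1"
  shows "0 < y j"
proof -
  have "\<bar>(y j - x j) / x j\<bar> < 1"
    using abs_le_L2_set[of UNIV j "\<lambda>j. (y j - x j) / x j"] assms(2) by simp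
  then have "\<bar>y j - x j\<bar> < x j" using assms(1) by simp
  then show ?thesis by linarith
qed

text \<open>
  The estimates for an inexact Newton step apply because refreshing makes every copy close and the
  rank-one updates restore the inverse. The full step stays positive, since a relative step of norm
  at most \<open>\<eta> < 1\<close> cannot reach the boundary.
\<close>
lemma iteration_near_path:
  fixes S :: "'n::finite ipm_state"
  assumes psd: "\<forall>x. 0 \<le> x \<bullet> (G *v x)" and S: "near_path G S"
    and us: "set us = I_gamma S \<union> I_theta S \<union> I_phi S \<union> I_psi S"
  defines "S' \<equiv> iteration us S"
  shows "near_path G S'"
    and "L2_set (\<lambda>j. (dual S' j - dual S j) / dual S j) UNIV \<le> eta"
    and "L2_set (\<lambda>j. (slack S' j - slack S j) / slack S j) UNIV \<le> eta"
proof -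
  define R where "R = fold rank1_update us (refresh S)"
  have S': "S' = newton_step R" by (simp add: S'_def R_def iteration_def)
  have R: "dual R = dual S" "slack R = slack S" "st_tau R = st_tau S"
    by (simp_all add: R_def stacked_defs)
  note S = S[unfolded near_path_def]
  from S have "\<forall>i. 0 < st_gamma S $ i \<and> 0 < st_theta S $ i \<and> 0 < st_phi S $ i \<and> 0 < st_psi S $ i \<and>
      0 < st_gamma_t S $ i \<and> 0 < st_theta_t S $ i \<and> 0 < st_phi_t S $ i \<and> 0 < st_psi_t S $ i"
    by (simp add: stacked_defs all_sum_type)
  then have close: "0 < dual_t R j" "dual_t R j \<le> (1 + delta) * dual S j" "dual S j \<le> (1 + delta) * dual_t R j"
      "0 < slack_t R j" "slack_t R j \<le> (1 + delta) * slack S j" "slack S j \<le> (1 + delta) * slack_t R j" for j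
    by (cases j; simp add: R_def stacked_defs renew_close)+
  have diagR: "diagonal R = diagonal (refresh S)" by (simp add: R_def)
  have "0 < diagonal (refresh S) $ i" for i
    using close(1,4)[of "Inl i"] close(1,4)[of "Inr i"] unfolding diagR[symmetric]
    by (simp add: diagonal_def stacked_defs add_pos_pos)
  moreover have "maintains_inverse G (refresh S)"
    using S unfolding maintains_inverse_def refresh_sel by blast
  ultimately have invR: "maintains_inverse G R"
    unfolding R_def by (intro maintains_inverse_fold[OF psd]) auto
  have dR: "st_d R = diagonal R"
  proof -
    \<comment> \<open>The copies at an index outside the update list are unchanged, so \<open>st_d\<close> is already correct there.\<close>
    have "st_d S $ i = diagonal (refresh S) $ i" if "i \<notin> set us" for i
      using that S by (simp add: us diagonal_def renew_def I_gamma_def I_theta_def I_phi_def I_psi_def)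
    then show ?thesis unfolding diagR by (simp add: R_def st_d_fold_rank1_update vec_eq_iff)
  qed
  define dv where "dv j = dual S' j - dual S j" for j
  define ds where "ds j = slack S' j - slack S j" for j
  have inv: "(G + diag (diagonal R)) ** st_M R = mat 1"
    using invR dR by (simp add: maintains_inverse_def)
  note eqs = newton_step_equations[OF psd inv, folded S', unfolded R]
  interpret inexact_newton UNIV "dual S" "slack S" "dual_t R" "slack_t R" dv ds "st_tau S" alpha delta
  proof
    show "dual_t R j * ds j + slack_t R j * dv j = st_tau S - dual S j * slack S j" for j
      using eqs(1) close by (simp add: dv_def ds_def)
    show "0 \<le> (\<Sum>j\<in>UNIV. dv j * ds j)"
      using eqs(2) close by (simp add: dv_def ds_def)
  qed (use S close alpha_delta_bounds in auto)
  show rel: "L2_set (\<lambda>j. (dual S' j - dual S j) / dual S j) UNIV \<le> eta"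
      "L2_set (\<lambda>j. (slack S' j - slack S j) / slack S j) UNIV \<le> eta"
    using relative_step_bound by (simp_all add: dv_def ds_def eta_def)
  have posS': "0 < dual S' j" "0 < slack S' j" for j
    using positive_if_relative_step_small[OF _ order.strict_trans1[OF rel(1) eta_bounds(2)], of j]
      positive_if_relative_step_small[OF _ order.strict_trans1[OF rel(2) eta_bounds(2)], of j] S
    by auto
  let ?n = "CARD('n)"
  let ?b = "beta ?n / sqrt (2 * real ?n)"
  have b: "0 < ?b" "?b < 1" using shrink_bounds[of ?n] by simp_all
  have tau: "0 < st_tau S" "st_tau S' = (1 - ?b) * st_tau S" using S by (simp_all add: S' R)
  have "L2_set (\<lambda>j. dual S' j * slack S' j - st_tau S') UNIV
      = L2_set (\<lambda>j. (dual S' j * slack S' j - st_tau S) + ?b * st_tau S) (UNIV :: ('n + 'n) set)"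
    by (simp add: tau algebra_simps)
  also have "\<dots> \<le> L2_set (\<lambda>j. dual S' j * slack S' j - st_tau S) UNIV
      + L2_set (\<lambda>j. ?b * st_tau S) (UNIV :: ('n + 'n) set)"
    by (rule L2_set_triangle_ineq)
  also have "\<dots> \<le> sigma * st_tau S + sqrt (2 * real ?n) * (?b * st_tau S)"
  proof (rule add_mono)
    show "L2_set (\<lambda>j. dual S' j * slack S' j - st_tau S) UNIV \<le> sigma * st_tau S"
      using residual_bound by (simp add: dv_def ds_def sigma_def)
    have "CARD('n + 'n) = 2 * ?n" by (simp add: card_UNIV_sum)
    then show "L2_set (\<lambda>j. ?b * st_tau S) (UNIV :: ('n + 'n) set) \<le> sqrt (2 * real ?n) * (?b * st_tau S)"
      using mult_pos_pos[OF b(1) tau(1)] by (simp only: L2_set_constant of_nat_mult of_nat_numeral abs_of_pos order_refl)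
  qed
  also have "\<dots> = (sigma + ?b * sqrt (2 * real ?n)) * st_tau S" by (simp add: algebra_simps)
  also have "\<dots> = (alpha * (1 - ?b)) * st_tau S"
    using beta_equation[of ?n] by simp
  finally have "L2_set (\<lambda>j. dual S' j * slack S' j - st_tau S') UNIV \<le> alpha * st_tau S'"
    by (simp add: tau mult.assoc)
  moreover have "dual_t S' = dual_t R" "slack_t S' = slack_t R" "diagonal S' = diagonal R"
      "st_d S' = st_d R" "maintains_inverse G S' = maintains_inverse G R"
    by (simp_all add: S' stacked_defs diagonal_def maintains_inverse_def)
  ultimately show "near_path G S'"
    using posS' close tau b dR invR by (simp add: near_path_def)
qed

text \<open>
  At the start the products are \<open>1 \<mp> \<lambda> h\<^sub>i / \<parallel>h\<parallel>\<^sub>\<infinity>\<close>, and \<open>\<lambda>\<close> is chosen so that \<open>2 n\<close> deviations of size at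
  most \<open>\<lambda>\<close> have Euclidean norm at most \<open>\<alpha>\<close>.
\<close>
lemma init_state_near_path:
  fixes H :: "real ^ 'n::finite ^ 'n" and h :: "real ^ 'n"
  assumes sym: "transpose H = H" and psd: "\<forall>x. 0 \<le> x \<bullet> (H *v x)" and h: "h \<noteq> 0"
  defines "G \<equiv> (2 * lambda CARD('n)) *\<^sub>R (1 / infnorm h) *\<^sub>R H"
  shows "\<forall>x. 0 \<le> x \<bullet> (G *v x)" and "near_path G (init_state H h)"
proof -
  let ?l = "lambda CARD('n)"
  have l: "0 < ?l" "?l < 1"
  proof -
    have "1 \<le> CARD('n)" by (simp add: Suc_le_eq)
    then have "1 \<le> sqrt (2 * real CARD('n))" by (simp del: One_nat_def)
    then have "alpha < sqrt (2 * real CARD('n))" using alpha_delta_bounds by linarith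
    then show "0 < ?l" "?l < 1"
      using alpha_delta_bounds by (simp_all add: lambda_def)
  qed
  have ih: "0 < infnorm h" using h by (simp add: infnorm_pos_lt)
  have small: "\<bar>h $ i / infnorm h\<bar> \<le> 1" for i
    using ih component_le_infnorm_cart[of h i] by simp
  have small': "\<bar>?l * (h $ i / infnorm h)\<bar> \<le> ?l" for i
    using mult_left_mono[OF small[of i], of ?l] l by (simp add: abs_mult)
  then have pos: "0 < 1 - ?l * (h $ i / infnorm h)" "0 < 1 + ?l * (h $ i / infnorm h)" for i
    using l by (smt (verit))+
  show psdG: "\<forall>x. 0 \<le> x \<bullet> (G *v x)"
    using psd l ih by (simp add: G_def flip: scaleR_matrix_vector_assoc)
  have symG: "transpose G = G"
    using sym by (simp add: G_def transpose_def vec_eq_iff)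
  let ?S = "init_state H h"
  have sel: "st_gamma ?S = (\<chi> i. 1 - ?l * (h $ i / infnorm h))" "st_theta ?S = (\<chi> i. 1 + ?l * (h $ i / infnorm h))"
      "st_phi ?S = (\<chi> i. 1)" "st_psi ?S = (\<chi> i. 1)" "st_tau ?S = 1"
      "st_gamma_t ?S = st_gamma ?S" "st_theta_t ?S = st_theta ?S" "st_phi_t ?S = st_phi ?S" "st_psi_t ?S = st_psi ?S"
      "st_d ?S = diagonal ?S" "st_M ?S = matrix_inv (G + diag (st_d ?S))"
    by (simp_all add: init_state_def Let_def diagonal_def G_def)
  have dpos: "\<forall>i. 0 < st_d ?S $ i"
    unfolding sel(10) by (simp add: diagonal_def sel)
  have "maintains_inverse G ?S"
    unfolding maintains_inverse_def sel(11)
    using symmetric_inverse_psd_plus_diag[OF symG psdG dpos] dpos by simp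
  moreover have "L2_set (\<lambda>j. dual ?S j * slack ?S j - st_tau ?S) UNIV \<le> alpha * st_tau ?S"
  proof -
    have "L2_set (\<lambda>j. dual ?S j * slack ?S j - st_tau ?S) UNIV
        = L2_set (\<lambda>j. \<bar>dual ?S j * slack ?S j - st_tau ?S\<bar>) UNIV"
      unfolding L2_set_def power2_abs ..
    also have "\<dots> \<le> L2_set (\<lambda>j. ?l) (UNIV :: ('n + 'n) set)"
    proof (rule L2_set_mono)
      show "\<bar>dual ?S j * slack ?S j - st_tau ?S\<bar> \<le> ?l" for j
        using small' by (cases j) (simp_all add: stacked_defs sel)
    qed simp
    also have "\<dots> = alpha"
      using alpha_delta_bounds by (simp add: L2_set_constant lambda_def)
    finally show ?thesis by (simp add: sel)
  qed
  ultimately show "near_path G ?S"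
    using pos unfolding near_path_def by (simp add: stacked_defs all_sum_type sel)
qed

section \<open>Logarithmic drift and stale entries\<close>

lemma abs_ln_ratio_le:
  fixes x y e :: real
  assumes x: "0 < x" and y: "0 < y" and e: "e < 1" and le: "\<bar>(y - x) / x\<bar> \<le> e"
  shows "\<bar>ln y - ln x\<bar> \<le> \<bar>(y - x) / x\<bar> / (1 - e)"
proof -
  define u where "u = (y - x) / x"
  have r: "y / x = 1 + u" "0 < y / x" using x y by (simp_all add: field_simps u_def)
  have le: "\<bar>u\<bar> \<le> e" using le by (simp add: u_def)
  have "ln y - ln x = ln (y / x)" using x y by (simp add: ln_div)
  moreover have "ln (y / x) \<le> u" using ln_add_one_self_le_self2[of u] r by simp
  moreover have "- ln (y / x) \<le> - u / (y / x)"
  proof -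
    have "- ln (y / x) = ln (x / y)" using x y by (simp add: ln_div)
    also have "\<dots> \<le> x / y - 1" using x y by (intro ln_le_minus_one) simp
    also have "\<dots> = - u / (y / x)" using x y by (simp add: field_simps u_def)
    finally show ?thesis .
  qed
  moreover have "- u / (y / x) \<le> \<bar>u\<bar> / (1 - e)"
    using le e r by (intro frac_le) (auto simp: abs_le_iff)
  moreover have "\<bar>u\<bar> \<le> \<bar>u\<bar> / (1 - e)"
    using le e divide_left_mono[of "1 - e" 1 "\<bar>u\<bar>"] by simp
  ultimately show ?thesis unfolding u_def[symmetric] by linarith
qed

lemma log_drift_le:
  fixes x y :: "'a::finite \<Rightarrow> real"
  assumes pos: "\<And>i. 0 < x i" "\<And>i. 0 < y i" and e: "e < 1"
    and le: "L2_set (\<lambda>i. (y i - x i) / x i) UNIV \<le> e"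
  shows "(\<Sum>i\<in>UNIV. \<bar>ln (y i) - ln (x i)\<bar>) \<le> sqrt (real CARD('a)) * e / (1 - e)"
proof -
  let ?u = "\<lambda>i. (y i - x i) / x i"
  have small: "\<bar>?u i\<bar> \<le> e" for i
    using abs_le_L2_set[of UNIV i ?u] le by simp
  have "(\<Sum>i\<in>UNIV. \<bar>ln (y i) - ln (x i)\<bar>) \<le> (\<Sum>i\<in>UNIV. \<bar>?u i\<bar> / (1 - e))"
    by (intro sum_mono abs_ln_ratio_le pos e small)
  also have "\<dots> = (\<Sum>i\<in>UNIV. \<bar>?u i\<bar> * \<bar>1\<bar>) / (1 - e)" by (simp add: sum_divide_distrib)
  also have "\<dots> \<le> (L2_set ?u UNIV * L2_set (\<lambda>_. 1) (UNIV :: 'a set)) / (1 - e)"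
    using e by (intro divide_right_mono L2_set_mult_ineq) simp
  also have "\<dots> \<le> (e * sqrt (real CARD('a))) / (1 - e)"
    using e le by (intro divide_right_mono) (auto simp: L2_set_constant intro: mult_right_mono)
  finally show ?thesis by (simp add: mult.commute)
qed

lemma stale_log:
  assumes "0 < x $ i" "0 < xt $ i" "i \<in> stale xt x"
  shows "ln (1 + delta) \<le> \<bar>ln (xt $ i) - ln (x $ i)\<bar>"
proof -
  have d: "0 < 1 + delta" using alpha_delta_bounds by simp
  have "xt $ i / x $ i < 1 / (1 + delta) \<or> 1 + delta < xt $ i / x $ i"
    using assms(3) by (auto simp: stale_def)
  then have "ln (xt $ i / x $ i) < ln (1 / (1 + delta)) \<or> ln (1 + delta) < ln (xt $ i / x $ i)"
    using assms d by simp
  then show ?thesis using assms d by (auto simp: ln_div)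
qed

text \<open>
  An amortized argument with the logarithmic distance between copies and true entries as potential.
  Movement of \<open>x\<close> raises the potential by at most its length, whereas refreshing a stale entry resets
  its share, which exceeds \<open>ln (1 + \<delta>)\<close>, to zero.
\<close>
lemma card_stale_le_log_drift:
  fixes x xt :: "nat \<Rightarrow> real ^ 'n"
  assumes start: "xt 1 = x 1"
    and step: "\<And>k. 1 \<le> k \<Longrightarrow> k < N \<Longrightarrow> xt (Suc k) = renew (xt k) (x k)"
    and pos: "\<And>k i. 1 \<le> k \<Longrightarrow> k \<le> N \<Longrightarrow> 0 < x k $ i \<and> 0 < xt k $ i"
    and N: "1 \<le> N"
  shows "ln (1 + delta) * (\<Sum>k=1..N. real (card (stale (xt k) (x k))))
    \<le> (\<Sum>k=1..<N. \<Sum>i\<in>UNIV. \<bar>ln (x (Suc k) $ i) - ln (x k $ i)\<bar>)"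
proof -
  define gap where "gap k = (\<Sum>i\<in>UNIV. \<bar>ln (renew (xt k) (x k) $ i) - ln (x k $ i)\<bar>)" for k
  \<comment> \<open>Each refresh is paid for by the potential that it releases.\<close>
  have spend: "ln (1 + delta) * real (card (stale (xt k) (x k))) + gap k
      \<le> (\<Sum>i\<in>UNIV. \<bar>ln (xt k $ i) - ln (x k $ i)\<bar>)" if "1 \<le> k" "k \<le> N" for k
  proof -
    have "ln (1 + delta) * real (card (stale (xt k) (x k)))
        = (\<Sum>i\<in>UNIV. if i \<in> stale (xt k) (x k) then ln (1 + delta) else 0)"
      by (simp add: sum.If_cases mult.commute)
    then have "ln (1 + delta) * real (card (stale (xt k) (x k))) + gap k
        = (\<Sum>i\<in>UNIV. (if i \<in> stale (xt k) (x k) then ln (1 + delta) else 0)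
             + \<bar>ln (renew (xt k) (x k) $ i) - ln (x k $ i)\<bar>)"
      by (simp add: gap_def sum.distrib)
    also have "\<dots> \<le> (\<Sum>i\<in>UNIV. \<bar>ln (xt k $ i) - ln (x k $ i)\<bar>)"
      using pos[OF that] stale_log by (intro sum_mono) (auto simp: renew_def)
    finally show ?thesis .
  qed
  have "ln (1 + delta) * (\<Sum>k=1..m. real (card (stale (xt k) (x k)))) + gap m
      \<le> (\<Sum>k=1..<m. \<Sum>i\<in>UNIV. \<bar>ln (x (Suc k) $ i) - ln (x k $ i)\<bar>)" if "1 \<le> m" "m \<le> N" for m
    using that
  proof (induction m rule: nat_induct_at_least)
    case base
    then show ?case using spend[of 1] start by simp
  next
    case (Suc m)
    have "(\<Sum>i\<in>UNIV. \<bar>ln (xt (Suc m) $ i) - ln (x (Suc m) $ i)\<bar>)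
        \<le> (\<Sum>i\<in>UNIV. \<bar>ln (xt (Suc m) $ i) - ln (x m $ i)\<bar> + \<bar>ln (x (Suc m) $ i) - ln (x m $ i)\<bar>)"
      by (rule sum_mono) linarith
    also have "\<dots> = gap m + (\<Sum>i\<in>UNIV. \<bar>ln (x (Suc m) $ i) - ln (x m $ i)\<bar>)"
      using step[of m] Suc by (simp add: gap_def sum.distrib)
    finally show ?case
      using spend[of "Suc m"] Suc by (simp add: distrib_left)
  qed
  from this[OF N order_refl] show ?thesis
    using sum_nonneg[of UNIV "\<lambda>i. \<bar>ln (renew (xt N) (x N) $ i) - ln (x N $ i)\<bar>"]
    unfolding gap_def by (meson abs_ge_zero add_increasing2 le_add_same_cancel1 order_trans)
qed

section \<open>The number of rank-one updates\<close>

lemma L2_set_sum_type_parts: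
  fixes f :: "'a::finite + 'a \<Rightarrow> real"
  shows "L2_set (\<lambda>i. f (Inl i)) UNIV \<le> L2_set f UNIV" "L2_set (\<lambda>i. f (Inr i)) UNIV \<le> L2_set f UNIV"
  unfolding L2_set_def sum_UNIV_sum_type by (simp_all add: sum_nonneg)

lemma iteration_log_drift:
  fixes S :: "'n::finite ipm_state"
  assumes psd: "\<forall>x. 0 \<le> x \<bullet> (G *v x)" and S: "near_path G S"
    and us: "set us = I_gamma S \<union> I_theta S \<union> I_phi S \<union> I_psi S"
  defines "S' \<equiv> iteration us S" and "B \<equiv> sqrt (real CARD('n)) * eta / (1 - eta)"
  shows "(\<Sum>i\<in>UNIV. \<bar>ln (st_gamma S' $ i) - ln (st_gamma S $ i)\<bar>) \<le> B"
    and "(\<Sum>i\<in>UNIV. \<bar>ln (st_theta S' $ i) - ln (st_theta S $ i)\<bar>) \<le> B"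
    and "(\<Sum>i\<in>UNIV. \<bar>ln (st_phi S' $ i) - ln (st_phi S $ i)\<bar>) \<le> B"
    and "(\<Sum>i\<in>UNIV. \<bar>ln (st_psi S' $ i) - ln (st_psi S $ i)\<bar>) \<le> B"
proof -
  note it = iteration_near_path[OF psd S us, folded S'_def]
  have pos: "0 < st_gamma R $ i" "0 < st_theta R $ i" "0 < st_phi R $ i" "0 < st_psi R $ i"
    if "near_path G R" for R :: "'n ipm_state" and i
    using that unfolding near_path_def by (simp_all add: stacked_defs all_sum_type)
  note parts = L2_set_sum_type_parts[of "\<lambda>j. (dual S' j - dual S j) / dual S j", THEN order_trans, OF it(2)]
    L2_set_sum_type_parts[of "\<lambda>j. (slack S' j - slack S j) / slack S j", THEN order_trans, OF it(3)]
  show "(\<Sum>i\<in>UNIV. \<bar>ln (st_gamma S' $ i) - ln (st_gamma S $ i)\<bar>) \<le> B"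
    unfolding B_def by (rule log_drift_le[OF pos(1)[OF S] pos(1)[OF it(1)] eta_bounds(2)])
      (use parts(1) in \<open>simp add: dual_def\<close>)
  show "(\<Sum>i\<in>UNIV. \<bar>ln (st_theta S' $ i) - ln (st_theta S $ i)\<bar>) \<le> B"
    unfolding B_def by (rule log_drift_le[OF pos(2)[OF S] pos(2)[OF it(1)] eta_bounds(2)])
      (use parts(2) in \<open>simp add: dual_def\<close>)
  show "(\<Sum>i\<in>UNIV. \<bar>ln (st_phi S' $ i) - ln (st_phi S $ i)\<bar>) \<le> B"
    unfolding B_def by (rule log_drift_le[OF pos(3)[OF S] pos(3)[OF it(1)] eta_bounds(2)])
      (use parts(3) in \<open>simp add: slack_def\<close>)
  show "(\<Sum>i\<in>UNIV. \<bar>ln (st_psi S' $ i) - ln (st_psi S $ i)\<bar>) \<le> B"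
    unfolding B_def by (rule log_drift_le[OF pos(4)[OF S] pos(4)[OF it(1)] eta_bounds(2)])
      (use parts(4) in \<open>simp add: slack_def\<close>)
qed

lemma iteration_tilde:
  "st_gamma_t (iteration us S) = renew (st_gamma_t S) (st_gamma S)"
  "st_theta_t (iteration us S) = renew (st_theta_t S) (st_theta S)"
  "st_phi_t (iteration us S) = renew (st_phi_t S) (st_phi S)"
  "st_psi_t (iteration us S) = renew (st_psi_t S) (st_psi S)"
  by (simp_all add: iteration_def)

theorem theorem2:
  fixes H :: "real ^ 'n ^ 'n" and h :: "real ^ 'n" and \<epsilon> :: real
    and S :: "nat \<Rightarrow> 'n ipm_state" and us :: "nat \<Rightarrow> 'n list"
  defines "n \<equiv> CARD('n)"
  defines "N \<equiv> N_iter n \<epsilon>"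
  assumes sym: "transpose H = H"
    and psd: "\<forall>x. 0 \<le> x \<bullet> (H *v x)"
    and h: "h \<noteq> 0"
    and eps: "0 < \<epsilon>" "\<epsilon> < 2 * real n + alpha * sqrt (2 * real n)"
    and run: "algorithm_run H h N S us"
  shows "(\<Sum>k=1..N. length (us k))
           = (\<Sum>k=1..N. card (I_gamma (S k) \<union> I_theta (S k) \<union> I_phi (S k) \<union> I_psi (S k))) \<and>
         int (\<Sum>k=1..N. card (I_gamma (S k) \<union> I_theta (S k) \<union> I_phi (S k) \<union> I_psi (S k)))
           \<le> \<lceil>4 * eta * (real N - 1) * sqrt (real n) / ((1 - eta) * ln (1 + delta))\<rceil>"
proof
  let ?I = "\<lambda>k. I_gamma (S k) \<union> I_theta (S k) \<union> I_phi (S k) \<union> I_psi (S k)"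
  let ?B = "sqrt (real n) * eta / (1 - eta)"
  define G where "G = (2 * lambda CARD('n)) *\<^sub>R (1 / infnorm h) *\<^sub>R H"
  have us: "distinct (us k)" "set (us k) = ?I k" "S (Suc k) = iteration (us k) (S k)"
    if "1 \<le> k" "k \<le> N" for k
    using run that by (auto simp: algorithm_run_def)
  have S1: "S 1 = init_state H h" using run by (simp add: algorithm_run_def)
  show "(\<Sum>k=1..N. length (us k)) = (\<Sum>k=1..N. card (?I k))"
    by (intro sum.cong refl) (metis atLeastAtMost_iff distinct_card us(1,2))
  have psdG: "\<forall>x. 0 \<le> x \<bullet> (G *v x)"
    unfolding G_def by (rule init_state_near_path[OF sym psd h])
  have near: "near_path G (S k)" if "1 \<le> k" "k \<le> N" for k
    using that
  proof (induction k rule: nat_induct_at_least)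
    case base
    show ?case unfolding S1 G_def by (rule init_state_near_path[OF sym psd h])
  next
    case (Suc k)
    then show ?case using us[of k] iteration_near_path(1)[OF psdG] by simp
  qed
  have pos: "0 < st_gamma (S k) $ i \<and> 0 < st_gamma_t (S k) $ i" "0 < st_theta (S k) $ i \<and> 0 < st_theta_t (S k) $ i"
      "0 < st_phi (S k) $ i \<and> 0 < st_phi_t (S k) $ i" "0 < st_psi (S k) $ i \<and> 0 < st_psi_t (S k) $ i"
    if "1 \<le> k" "k \<le> N" for k i
    using near[OF that] unfolding near_path_def by (simp_all add: stacked_defs all_sum_type)
  have start: "st_gamma_t (S 1) = st_gamma (S 1)" "st_theta_t (S 1) = st_theta (S 1)"
      "st_phi_t (S 1) = st_phi (S 1)" "st_psi_t (S 1) = st_psi (S 1)"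
    unfolding S1 by (simp_all add: init_state_def Let_def)
  have N: "1 \<le> N" unfolding N_def using N_iter_pos eps by (simp add: n_def)
  have L: "0 < ln (1 + delta)" using alpha_delta_bounds by simp
  \<comment> \<open>The amortized bound for any one of the four vectors, given its movement per step.\<close>
  have count: "ln (1 + delta) * (\<Sum>k=1..N. real (card (stale (xt (S k)) (x (S k))))) \<le> real (N - 1) * ?B"
    if "xt (S 1) = x (S 1)" and "\<And>k. 1 \<le> k \<Longrightarrow> k < N \<Longrightarrow> xt (S (Suc k)) = renew (xt (S k)) (x (S k))"
      and "\<And>k i. 1 \<le> k \<Longrightarrow> k \<le> N \<Longrightarrow> 0 < x (S k) $ i \<and> 0 < xt (S k) $ i"
      and drift: "\<And>k. 1 \<le> k \<Longrightarrow> k < N \<Longrightarrow> (\<Sum>i\<in>UNIV. \<bar>ln (x (S (Suc k)) $ i) - ln (x (S k) $ i)\<bar>) \<le> ?B"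
    for x xt :: "'n ipm_state \<Rightarrow> real ^ 'n"
  proof -
    have "ln (1 + delta) * (\<Sum>k=1..N. real (card (stale (xt (S k)) (x (S k)))))
        \<le> (\<Sum>k=1..<N. \<Sum>i\<in>UNIV. \<bar>ln (x (S (Suc k)) $ i) - ln (x (S k) $ i)\<bar>)"
      using that N by (intro card_stale_le_log_drift[of "\<lambda>k. xt (S k)" "\<lambda>k. x (S k)"]) auto
    also have "\<dots> \<le> (\<Sum>k=1..<N. ?B)" using drift by (intro sum_mono) auto
    finally show ?thesis by simp
  qed
  have step: "S (Suc k) = iteration (us k) (S k)" if "1 \<le> k" "k < N" for k using us(3) that by simp
  have drift: "near_path G (S k)" "set (us k) = ?I k" if "1 \<le> k" "k < N" for k
    using near us(2) that by simp_all
  note drift = iteration_log_drift[OF psdG drift, folded n_def]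
  define C where "C = real (N - 1) * ?B"
  have counts: "ln (1 + delta) * (\<Sum>k=1..N. real (card (I_gamma (S k)))) \<le> real (N - 1) * ?B"
      "ln (1 + delta) * (\<Sum>k=1..N. real (card (I_theta (S k)))) \<le> real (N - 1) * ?B"
      "ln (1 + delta) * (\<Sum>k=1..N. real (card (I_phi (S k)))) \<le> real (N - 1) * ?B"
      "ln (1 + delta) * (\<Sum>k=1..N. real (card (I_psi (S k)))) \<le> real (N - 1) * ?B"
    unfolding I_gamma_def I_theta_def I_phi_def I_psi_def
    by (intro count start pos; simp only: step iteration_tilde drift)+
  have "real (\<Sum>k=1..N. card (?I k)) \<le> (\<Sum>k=1..N. real (card (I_gamma (S k))) + real (card (I_theta (S k)))
      + real (card (I_phi (S k))) + real (card (I_psi (S k))))"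
  proof (subst of_nat_sum, rule sum_mono)
    fix k
    have "card (?I k) \<le> card (I_gamma (S k)) + card (I_theta (S k)) + card (I_phi (S k)) + card (I_psi (S k))"
      by (meson add_mono card_Un_le order_refl order_trans)
    then show "real (card (?I k)) \<le> real (card (I_gamma (S k))) + real (card (I_theta (S k)))
      + real (card (I_phi (S k))) + real (card (I_psi (S k)))" by linarith
  qed
  then have "ln (1 + delta) * real (\<Sum>k=1..N. card (?I k)) \<le> ln (1 + delta) *
      (\<Sum>k=1..N. real (card (I_gamma (S k))) + real (card (I_theta (S k)))
      + real (card (I_phi (S k))) + real (card (I_psi (S k))))"
    using L by (intro mult_left_mono) auto
  also have "\<dots> \<le> 4 * (real (N - 1) * ?B)"
    using counts[folded C_def] unfolding C_def[symmetric] sum.distrib distrib_left by linarith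
  finally have "real (\<Sum>k=1..N. card (?I k)) \<le> 4 * (real (N - 1) * ?B) / ln (1 + delta)"
    by (simp only: pos_le_divide_eq[OF L] mult.commute[of _ "ln (1 + delta)"])
  also have "\<dots> = 4 * eta * (real N - 1) * sqrt (real n) / ((1 - eta) * ln (1 + delta))"
    using N by (simp add: of_nat_diff)
  finally have "real_of_int (int (\<Sum>k=1..N. card (?I k))) \<le> \<dots>" by simp
  then show "int (\<Sum>k=1..N. card (?I k))
      \<le> \<lceil>4 * eta * (real N - 1) * sqrt (real n) / ((1 - eta) * ln (1 + delta))\<rceil>"
    by linarith
qed

end
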